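(* Let $2<\alpha<3$, $0<\varepsilon\le\frac12$, and let $\gamma\in C^\infty(\mathbb R/\mathbb Z,\mathbb R^n)$ be a simple closed curve parametrized by arc length. There is an analytic function $G_1^\alpha:(\mathbb R^n\setminus\{0,1\})\times\mathbb R^{4n}\to\mathbb R^n$ (independent of $\gamma$ and $\varepsilon$), such that for all $x\in\mathbb R/\mathbb Z$, $$(P^\perp_{\dot\gamma}R_1^{\alpha,\varepsilon}\gamma)(x)=\int_{|w|\in[\varepsilon,\frac12]}\iiiint_{[0,1]^4}(r_1-r_2)^2\,G_1^\alpha\Big(\int_0^1\dot\gamma(x+sw)\,\mathrm ds,\ \dot\gamma(x),\ \ddot\gamma(x+r_2w+(r_1-r_2)\psi_1w),\ \ddot\gamma(x+r_2w+(r_1-r_2)\psi_2w),\ \int_0^1\ddot\gamma(x+tw)(1-t)\,\mathrm dt\Big)\,\mathrm d\psi_1\,\mathrm d\psi_2\,\mathrm dr_1\,\mathrm dr_2\,\frac{\mathrm dw}{|w|^{\alpha-2}}.$$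
   Context: $(R_1^{\alpha,\varepsilon}\gamma)(x)=\int_{|w|\in[\varepsilon,\frac12]}(\gamma(x+w)-\gamma(x)-w\dot\gamma(x))\Big(\frac{1}{|\gamma(x+w)-\gamma(x)|^{\alpha+2}}-\frac{1}{|w|^{\alpha+2}}\Big)\mathrm dw$. For $v\in\mathbb R^n$, $P^\perp_{\dot\gamma(x)}v=v-\langle v,\dot\gamma(x)\rangle\dot\gamma(x)$ and $(P^\perp_{\dot\gamma}u)(x)=P^\perp_{\dot\gamma(x)}u(x)$. Here "$\mathbb R^n\setminus\{0,1\}$" means the first argument $a$ avoids $|a|\in\{0,1\}$ (the function involves $g(a)=\frac{1}{2|a|^{\alpha+2}}\frac{1-|a|^{\alpha+2}}{1-|a|^2}$). *)

theory Defs
  imports "HOL-Analysis.Analysis"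
begin

definition vderiv :: "(real \<Rightarrow> 'a::real_normed_vector) \<Rightarrow> real \<Rightarrow> 'a" where
  "vderiv f = (\<lambda>x. vector_derivative f (at x))"

definition smooth_curve :: "(real \<Rightarrow> 'a::real_normed_vector) \<Rightarrow> bool" where
  "smooth_curve f \<longleftrightarrow> (\<forall>k x. ((vderiv ^^ k) f) differentiable (at x))"

definition multi_indices :: "'a::euclidean_space itself \<Rightarrow> ('a \<Rightarrow> nat) set" where
  "multi_indices _ = {\<kappa>. \<forall>i. i \<notin> Basis \<longrightarrow> \<kappa> i = 0}"

definition real_analytic_on :: "('a::euclidean_space \<Rightarrow> 'b::real_normed_vector) \<Rightarrow> 'a set \<Rightarrow> bool" where
  "real_analytic_on f U \<longleftrightarrow>
     (\<forall>p\<in>U. \<exists>r>0. \<exists>c :: ('a \<Rightarrow> nat) \<Rightarrow> 'b. \<forall>y\<in>ball p r.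
        ((\<lambda>\<kappa>. (\<Prod>b\<in>Basis. ((y - p) \<bullet> b) ^ \<kappa> b) *\<^sub>R c \<kappa>) has_sum f y) (multi_indices TYPE('a)))"

definition Pperp :: "'a::real_inner \<Rightarrow> 'a \<Rightarrow> 'a" where
  "Pperp t v = v - (v \<bullet> t) *\<^sub>R t"

definition Rdom :: "real \<Rightarrow> real set" where
  "Rdom \<epsilon> = {w. \<epsilon> \<le> \<bar>w\<bar> \<and> \<bar>w\<bar> \<le> 1/2}"

definition R1 :: "real \<Rightarrow> real \<Rightarrow> (real \<Rightarrow> 'a::euclidean_space) \<Rightarrow> real \<Rightarrow> 'a" where
  "R1 \<alpha> \<epsilon> \<gamma> x = integral (Rdom \<epsilon>) (\<lambda>w.
     (1 / norm (\<gamma> (x + w) - \<gamma> x) powr (\<alpha> + 2) - 1 / \<bar>w\<bar> powr (\<alpha> + 2)) *\<^sub>R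
     (\<gamma> (x + w) - \<gamma> x - w *\<^sub>R vderiv \<gamma> x))"

definition G_domain :: "('a::real_normed_vector \<times> 'a \<times> 'a \<times> 'a \<times> 'a) set" where
  "G_domain = {(a, b, c, d, e). norm a \<noteq> 0 \<and> norm a \<noteq> 1}"

end

(* Write the chord as gamma(x+w) - gamma(x) = w a, where a is the mean of the tangent on [x,x+w].
   Then 1/|w a|^(alpha+2) - 1/|w|^(alpha+2) = 2 g(a) (1 - |a|^2) / |w|^(alpha+2), and since the
   tangent T has unit length, 2 (1 - |a|^2) is the mean over r1, r2 of |T(x+r1 w) - T(x+r2 w)|^2,
   that is of w^2 (r1-r2)^2 times the mean over psi1, psi2 of the inner product of the second
   derivatives. By Taylor's formula the other factor of the integrand is w^2 e, so that
   G(a,b,c,d,e) = g(a) <c,d> P_b e works. Its analyticity reduces to that of sums, products and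
   real powers of a positive analytic function, obtained by regrouping absolutely convergent
   multiple series. Curves with straight pieces, where |a| = 1, need no separate treatment
   because the factor 1 - |a|^2 vanishes there. *)
theory Submission
  imports Defs
begin

section \<open>Real-analytic functions\<close>

definition mpow :: "'a::euclidean_space \<Rightarrow> ('a \<Rightarrow> nat) \<Rightarrow> real" where
  "mpow v \<kappa> = (\<Prod>b\<in>Basis. (v \<bullet> b) ^ \<kappa> b)"

text \<open>Analyticity is localized to one point so that the closure rules can carry conditions at
  that point, such as a positive base or a nonzero denominator.\<close>

definition real_analytic_at :: "('a::euclidean_space \<Rightarrow> 'b::real_normed_vector) \<Rightarrow> 'a \<Rightarrow> bool" where
  "real_analytic_at f p \<longleftrightarrow> (\<exists>r>0. \<exists>c. \<forall>y\<in>ball p r.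
     ((\<lambda>\<kappa>. mpow (y - p) \<kappa> *\<^sub>R c \<kappa>) has_sum f y) (multi_indices TYPE('a)))"

lemma real_analytic_atI:
  fixes f :: "'a::euclidean_space \<Rightarrow> 'b::real_normed_vector"
  assumes "r > 0" and "\<And>y. y \<in> ball p r \<Longrightarrow>
    ((\<lambda>\<kappa>. mpow (y - p) \<kappa> *\<^sub>R c \<kappa>) has_sum f y) (multi_indices TYPE('a))"
  shows "real_analytic_at f p"
  unfolding real_analytic_at_def using assms by (intro exI conjI ballI)

lemma real_analytic_atE:
  fixes f :: "'a::euclidean_space \<Rightarrow> 'b::real_normed_vector"
  assumes "real_analytic_at f p"
  obtains r c where "r > 0" and "\<And>y. y \<in> ball p r \<Longrightarrow>
    ((\<lambda>\<kappa>. mpow (y - p) \<kappa> *\<^sub>R c \<kappa>) has_sum f y) (multi_indices TYPE('a))"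
  using assms unfolding real_analytic_at_def by (elim exE conjE) (rule that, auto simp del: mem_ball)

lemma real_analytic_on_iff_at: "real_analytic_on f U \<longleftrightarrow> (\<forall>p\<in>U. real_analytic_at f p)"
  by (simp add: real_analytic_on_def real_analytic_at_def mpow_def)

text \<open>On the diagonal a monomial depends only on its degree, and for \<open>t > 0\<close> it
  is nonzero. Diagonal points thus serve as test points where convergence of the series controls its
  coefficients.\<close>

lemma mpow_One: "mpow (t *\<^sub>R \<Sum>Basis :: 'a::euclidean_space) \<kappa> = t ^ (\<Sum>b\<in>(Basis :: 'a set). \<kappa> b)"
proof -
  have "(\<Sum>Basis) \<bullet> b = 1" if "b \<in> Basis" for b :: 'a
    using that by (simp add: inner_sum_left inner_Basis)
  thus ?thesis by (simp add: mpow_def power_sum)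
qed

lemma mpow_zero_index [simp]: "mpow v (\<lambda>_. 0) = 1"
  by (simp add: mpow_def)

lemma multi_index_size_pos:
  fixes \<kappa> :: "'a::euclidean_space \<Rightarrow> nat"
  assumes "\<kappa> \<in> multi_indices TYPE('a)" "\<kappa> \<noteq> (\<lambda>_. 0)"
  shows "(\<Sum>b\<in>Basis. \<kappa> b) > 0"
proof (rule ccontr)
  assume "\<not> ?thesis"
  then have "\<kappa> b = 0" for b
    using assms(1) by (cases "b \<in> Basis") (auto simp: multi_indices_def)
  with assms(2) show False by auto
qed

lemma mpow_at_zero:
  fixes \<kappa> :: "'a::euclidean_space \<Rightarrow> nat"
  assumes "\<kappa> \<in> multi_indices TYPE('a)" "\<kappa> \<noteq> (\<lambda>_. 0)"
  shows "mpow 0 \<kappa> = 0"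
  using mpow_One[of 0 \<kappa>] multi_index_size_pos[OF assms] by simp

lemma mpow_add: "mpow v (\<lambda>b. \<kappa> b + \<mu> b) = mpow v \<kappa> * mpow v \<mu>"
  by (simp add: mpow_def power_add prod.distrib)

lemma mpow_sum_list:
  "mpow v (\<lambda>b. \<Sum>\<kappa>\<leftarrow>l. \<kappa> b) = (\<Prod>\<kappa>\<leftarrow>l. mpow v \<kappa>)"
  by (induction l) (simp_all add: mpow_add)

lemma abs_mpow_le:
  fixes v :: "'a::euclidean_space"
  assumes "norm v \<le> s"
  shows "\<bar>mpow v \<kappa>\<bar> \<le> s ^ (\<Sum>b\<in>(Basis :: 'a set). \<kappa> b)"
proof -
  have "\<bar>mpow v \<kappa>\<bar> = (\<Prod>b\<in>Basis. \<bar>v \<bullet> b\<bar> ^ \<kappa> b)"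
    by (simp add: mpow_def abs_prod power_abs)
  also have "\<dots> \<le> (\<Prod>b\<in>(Basis :: 'a set). s ^ \<kappa> b)"
    using assms by (intro prod_mono conjI power_mono) (auto intro: order_trans[OF Basis_le_norm])
  finally show ?thesis by (simp add: power_sum)
qed

text \<open>The series may be indexed by an arbitrary set. The fibre over each multi-index is summable because
  the series converges at a point near \<open>p\<close> where no coordinate vanishes.\<close>

lemma real_analytic_at_regroup:
  fixes f :: "'a::euclidean_space \<Rightarrow> real"
  assumes "r > 0" and k: "k ` I \<subseteq> multi_indices TYPE('a)"
    and sum: "\<And>y. y \<in> ball p r \<Longrightarrow> ((\<lambda>i. mpow (y - p) (k i) * a i) has_sum f y) I"
  shows "real_analytic_at f p"
proof -
  define J where "J \<kappa> = {i\<in>I. k i = \<kappa>}" for \<kappa>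
  \<comment> \<open>The factor 2 puts the diagonal point
    \<open>p + t *\<^sub>R (\<Sum>Basis)\<close> strictly inside the ball.\<close>
  define t where "t = r / (2 * norm (\<Sum>Basis :: 'a))"
  have "(\<Sum>Basis :: 'a) \<noteq> 0"
  proof
    assume "(\<Sum>Basis :: 'a) = 0"
    obtain b :: 'a where "b \<in> Basis" using nonempty_Basis by blast
    then have "(\<Sum>Basis) \<bullet> b = 1" by (simp add: inner_sum_left inner_Basis)
    with \<open>(\<Sum>Basis :: 'a) = 0\<close> show False by simp
  qed
  then have t: "t > 0" "norm (t *\<^sub>R (\<Sum>Basis :: 'a)) < r"
    using \<open>r > 0\<close> by (auto simp: t_def)
  have a: "a summable_on J \<kappa>" for \<kappa>
  proof -
    have "p + t *\<^sub>R (\<Sum>Basis) \<in> ball p r"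
      using t by (simp add: dist_norm)
    from has_sum_imp_summable[OF sum[OF this]]
    have "(\<lambda>i. mpow (t *\<^sub>R \<Sum>Basis) (k i) * a i) summable_on I" by simp
    then have "(\<lambda>i. mpow (t *\<^sub>R \<Sum>Basis) (k i) * a i) summable_on J \<kappa>"
      by (rule summable_on_subset_banach) (auto simp: J_def)
    \<comment> \<open>On the fibre the monomial is constant, a power of \<open>t > 0\<close>, and
      can be cancelled.\<close>
    also have "?this \<longleftrightarrow> (\<lambda>i. mpow (t *\<^sub>R \<Sum>Basis) \<kappa> * a i) summable_on J \<kappa>"
      by (rule summable_on_cong) (simp add: J_def)
    finally show ?thesis
      using t by (simp add: mpow_One summable_on_cmult_right')
  qed
  have "((\<lambda>\<kappa>. mpow (y - p) \<kappa> *\<^sub>R infsum a (J \<kappa>)) has_sum f y) (multi_indices TYPE('a))"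
    if "y \<in> ball p r" for y
  proof (rule has_sum_SigmaD[where B = J and f = "\<lambda>(\<kappa>, i). mpow (y - p) (k i) * a i"])
    \<comment> \<open>Tagging \<open>i\<close> with \<open>k i\<close> presents \<open>I\<close> as
      the disjoint union of the fibres \<open>J \<kappa>\<close>, each of which is summed
      first.\<close>
    have bij: "bij_betw (\<lambda>i. (k i, i)) I (Sigma (multi_indices TYPE('a)) J)"
      using k by (auto simp: bij_betw_def inj_on_def J_def)
    show "((\<lambda>(\<kappa>, i). mpow (y - p) (k i) * a i) has_sum f y) (Sigma (multi_indices TYPE('a)) J)"
      using sum[OF that] by (subst has_sum_reindex_bij_betw[OF bij, symmetric]) simp
  next
    fix \<kappa> :: "'a \<Rightarrow> nat"
    have "((\<lambda>i. mpow (y - p) \<kappa> * a i) has_sum mpow (y - p) \<kappa> * infsum a (J \<kappa>)) (J \<kappa>)"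
      by (intro has_sum_cmult_right has_sum_infsum a)
    also have "?this \<longleftrightarrow> ((\<lambda>i. mpow (y - p) (k i) * a i) has_sum mpow (y - p) \<kappa> * infsum a (J \<kappa>)) (J \<kappa>)"
      by (rule has_sum_cong) (simp add: J_def)
    finally show "((\<lambda>i. case (\<kappa>, i) of (\<kappa>, i) \<Rightarrow> mpow (y - p) (k i) * a i) has_sum
                    mpow (y - p) \<kappa> *\<^sub>R infsum a (J \<kappa>)) (J \<kappa>)" by simp
  qed
  with \<open>r > 0\<close> show ?thesis by (rule real_analytic_atI)
qed

section \<open>Products and powers of absolutely convergent series\<close>

text \<open>Unordered summability of real families is absolute, so the family of products is
  absolutely summable and its sum may be computed iteratively.\<close>

lemma has_sum_mult_Times:
  fixes f :: "'i \<Rightarrow> real" and g :: "'j \<Rightarrow> real"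
  assumes f: "(f has_sum a) A" and g: "(g has_sum b) B"
  shows "((\<lambda>(x, y). f x * g y) has_sum a * b) (A \<times> B)"
proof (rule has_sum_SigmaI[where g = "\<lambda>x. f x * b"])
  show "((\<lambda>y. case (x, y) of (x, y) \<Rightarrow> f x * g y) has_sum f x * b) B" for x
    using has_sum_cmult_right[OF g] by simp
  show "((\<lambda>x. f x * b) has_sum a * b) A"
    by (rule has_sum_cmult_left[OF f])
  have "(\<lambda>x. norm (f x)) summable_on A" "(\<lambda>x. norm (g x)) summable_on B"
    using f g by (auto simp flip: summable_on_iff_abs_summable_on_real simp del: real_norm_def dest: has_sum_imp_summable)
  then have "(\<lambda>z. norm (case z of (x, y) \<Rightarrow> f x * g y)) summable_on A \<times> B"
    by (subst Infinite_Sum.abs_summable_on_Sigma_iff) (auto simp: abs_mult infsum_cmult_right'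
        intro!: summable_on_cmult_right summable_on_cmult_left)
  then show "(\<lambda>(x, y). f x * g y) summable_on A \<times> B"
    by (rule abs_summable_summable)
qed

text \<open>Multiplying out \<open>U ^ k\<close> chooses one term from each factor, and a list
  records the choices. \<open>Cons\<close> splits off the first choice, so the induction step is a
  product of two series.\<close>

lemma has_sum_prod_list:
  fixes u :: "'i \<Rightarrow> real"
  assumes "(u has_sum U) M"
  shows "((\<lambda>l. \<Prod>i\<leftarrow>l. u i) has_sum U ^ k) {l \<in> lists M. length l = k}"
proof (induction k)
  case 0
  have "{l \<in> lists M. length l = 0} = {[]}" by auto
  then show ?case by (simp add: has_sum_finiteI)
next
  case (Suc k)
  have bij: "bij_betw (\<lambda>(i, l). i # l) (M \<times> {l \<in> lists M. length l = k}) {l \<in> lists M. length l = Suc k}"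
    by (auto simp: bij_betw_def inj_on_def length_Suc_conv image_iff)
  show ?case
    using has_sum_mult_Times[OF assms Suc]
    by (subst has_sum_reindex_bij_betw[OF bij, symmetric]) (simp add: case_prod_unfold)
qed

text \<open>A list of length \<open>k\<close> stands for one term of the expansion of
  \<open>U ^ k\<close>. Rearranging the double series over \<open>k\<close> and lists is justified
  by the majorant in \<open>F\<close>, the absolute sum of \<open>u\<close>.\<close>

lemma has_sum_lists_power_series:
  fixes u :: "'i \<Rightarrow> real"
  assumes u: "(u has_sum U) M" and F: "((\<lambda>i. \<bar>u i\<bar>) has_sum F) M"
    and abs: "summable (\<lambda>k. \<bar>h k\<bar> * F ^ k)" and V: "(\<lambda>k. h k * U ^ k) sums V"
  shows "((\<lambda>l. h (length l) * (\<Prod>i\<leftarrow>l. u i)) has_sum V) (lists M)"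
proof -
  define L where "L k = {l \<in> lists M. length l = k}" for k
  \<comment> \<open>The length is kept as a separate coordinate, so that the sum over lists splits
    into an outer sum over \<open>k\<close> and inner sums over \<open>L k\<close>.\<close>
  define X where "X = (\<lambda>(k, l). h k * (\<Prod>i\<leftarrow>l. u i))"
  have absU: "\<bar>U\<bar> \<le> F"
    using norm_has_sum_bound[of u M F U] u F by simp
  have "F \<ge> 0" using F has_sum_nonneg by fastforce
  have abs_list: "\<bar>\<Prod>i\<leftarrow>l. u i\<bar> = (\<Prod>i\<leftarrow>l. \<bar>u i\<bar>)" for l
    by (induction l) (auto simp: abs_mult)
  have sumF: "((\<lambda>l. \<bar>X (k, l)\<bar>) has_sum \<bar>h k\<bar> * F ^ k) (L k)" for k
    using has_sum_cmult_right[OF has_sum_prod_list[OF F], of "\<bar>h k\<bar>" k]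
    by (simp add: X_def L_def abs_mult abs_list)
  have "(\<lambda>x. \<bar>X x\<bar>) summable_on (SIGMA k:UNIV. L k)"
  proof (rule summable_on_SigmaI)
    show "((\<lambda>l. \<bar>X (k, l)\<bar>) has_sum \<bar>h k\<bar> * F ^ k) (L k)" for k by (rule sumF)
    show "(\<lambda>k. \<bar>h k\<bar> * F ^ k) summable_on UNIV"
      using abs \<open>F \<ge> 0\<close> by (subst summable_on_UNIV_nonneg_real_iff) auto
  qed auto
  then have summ: "X summable_on (SIGMA k:UNIV. L k)"
    using summable_on_iff_abs_summable_on_real[of X] by simp
  have "(X has_sum V) (SIGMA k:UNIV. L k)"
  proof (rule has_sum_SigmaI[where g = "\<lambda>k. h k * U ^ k"])
    show "((\<lambda>l. X (k, l)) has_sum h k * U ^ k) (L k)" for k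
      using has_sum_cmult_right[OF has_sum_prod_list[OF u]] by (simp add: X_def L_def)
    \<comment> \<open>Since \<open>\<bar>U\<bar> \<le> F\<close>, the majorant in \<open>F\<close>
      also dominates the outer series.\<close>
    have "summable (\<lambda>k. norm (h k * U ^ k))"
      by (rule summable_comparison_test'[OF abs, of 0])
        (auto simp: abs_mult power_abs intro!: mult_left_mono power_mono absU)
    then show "((\<lambda>k. h k * U ^ k) has_sum V) UNIV"
      by (rule norm_summable_imp_has_sum[OF _ V])
  qed (rule summ)
  moreover have bij: "bij_betw (\<lambda>l. (length l, l)) (lists M) (SIGMA k:UNIV. L k)"
    by (auto simp: bij_betw_def inj_on_def L_def)
  ultimately show ?thesis
    by (subst (asm) has_sum_reindex_bij_betw[OF bij, symmetric]) (simp add: X_def)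
qed

section \<open>Closure of real analyticity under algebraic operations and real powers\<close>

lemma real_analytic_at_const: "real_analytic_at (\<lambda>_. v) (p :: 'a::euclidean_space)"
proof -
  have "((\<lambda>\<kappa>. mpow (y - p) \<kappa> *\<^sub>R (if \<kappa> = (\<lambda>_. 0) then v else 0)) has_sum v) (multi_indices TYPE('a))"
    for y :: 'a
    by (rule has_sum_finite_neutralI[of "{\<lambda>_. 0}"]) (auto simp: multi_indices_def)
  with zero_less_one show ?thesis by (rule real_analytic_atI)
qed

lemma real_analytic_at_add:
  fixes f g :: "'a::euclidean_space \<Rightarrow> 'b::real_normed_vector"
  assumes "real_analytic_at f p" "real_analytic_at g p"
  shows "real_analytic_at (\<lambda>x. f x + g x) p"
proof -
  obtain r c where "r > 0" and r: "\<And>y. y \<in> ball p r \<Longrightarrow>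
      ((\<lambda>\<kappa>. mpow (y - p) \<kappa> *\<^sub>R c \<kappa>) has_sum f y) (multi_indices TYPE('a))"
    by (rule real_analytic_atE[OF assms(1)]) (rule that)
  obtain s d where "s > 0" and s: "\<And>y. y \<in> ball p s \<Longrightarrow>
      ((\<lambda>\<kappa>. mpow (y - p) \<kappa> *\<^sub>R d \<kappa>) has_sum g y) (multi_indices TYPE('a))"
    by (rule real_analytic_atE[OF assms(2)]) (rule that)
  have "((\<lambda>\<kappa>. mpow (y - p) \<kappa> *\<^sub>R (c \<kappa> + d \<kappa>)) has_sum f y + g y) (multi_indices TYPE('a))"
    if "y \<in> ball p (min r s)" for y
    using that by (auto simp: scaleR_add_right intro!: has_sum_add r s)
  moreover have "min r s > 0" using \<open>r > 0\<close> \<open>s > 0\<close> by simp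
  ultimately show ?thesis by (rule real_analytic_atI[rotated])
qed

lemma real_analytic_at_sum:
  "(\<And>i. i \<in> I \<Longrightarrow> real_analytic_at (f i) p) \<Longrightarrow> real_analytic_at (\<lambda>x. \<Sum>i\<in>I. f i x) p"
  by (induction I rule: infinite_finite_induct)
    (auto intro: real_analytic_at_const real_analytic_at_add)

lemma real_analytic_at_scaleR_const:
  fixes f :: "'a::euclidean_space \<Rightarrow> real"
  assumes "real_analytic_at f p"
  shows "real_analytic_at (\<lambda>x. f x *\<^sub>R v) p"
proof -
  obtain r c where "r > 0" and r: "\<And>y. y \<in> ball p r \<Longrightarrow>
      ((\<lambda>\<kappa>. mpow (y - p) \<kappa> *\<^sub>R c \<kappa>) has_sum f y) (multi_indices TYPE('a))"
    by (rule real_analytic_atE[OF assms]) (rule that)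
  have "((\<lambda>\<kappa>. mpow (y - p) \<kappa> *\<^sub>R (c \<kappa> *\<^sub>R v)) has_sum f y *\<^sub>R v) (multi_indices TYPE('a))"
    if "y \<in> ball p r" for y
    using has_sum_bounded_linear[OF bounded_linear_scaleR_left r[OF that], of v]
    by (simp add: o_def)
  with \<open>r > 0\<close> show ?thesis by (rule real_analytic_atI)
qed

text \<open>This is the Cauchy product: the two series multiply to a series over pairs of
  multi-indices, which is regrouped by the sum of the pair.\<close>

lemma real_analytic_at_mult:
  fixes f g :: "'a::euclidean_space \<Rightarrow> real"
  assumes "real_analytic_at f p" "real_analytic_at g p"
  shows "real_analytic_at (\<lambda>x. f x * g x) p"
proof -
  let ?M = "multi_indices TYPE('a)"
  obtain r c where "r > 0" and r: "\<And>y. y \<in> ball p r \<Longrightarrow>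
      ((\<lambda>\<kappa>. mpow (y - p) \<kappa> *\<^sub>R c \<kappa>) has_sum f y) ?M"
    by (rule real_analytic_atE[OF assms(1)]) (rule that)
  obtain s d where "s > 0" and s: "\<And>y. y \<in> ball p s \<Longrightarrow>
      ((\<lambda>\<kappa>. mpow (y - p) \<kappa> *\<^sub>R d \<kappa>) has_sum g y) ?M"
    by (rule real_analytic_atE[OF assms(2)]) (rule that)
  show ?thesis
  proof (rule real_analytic_at_regroup[where r = "min r s" and I = "?M \<times> ?M"
        and k = "\<lambda>(\<kappa>, \<mu>) b. \<kappa> b + \<mu> b" and a = "\<lambda>(\<kappa>, \<mu>). c \<kappa> * d \<mu>"])
    show "((\<lambda>i. mpow (y - p) (case i of (\<kappa>, \<mu>) \<Rightarrow> \<lambda>b. \<kappa> b + \<mu> b) * (case i of (\<kappa>, \<mu>) \<Rightarrow> c \<kappa> * d \<mu>))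
            has_sum f y * g y) (?M \<times> ?M)" if "y \<in> ball p (min r s)" for y
      using has_sum_mult_Times[OF r[of y] s[of y]] that
      by (simp add: mpow_add case_prod_unfold mult_ac)
  qed (use \<open>r > 0\<close> \<open>s > 0\<close> in \<open>auto simp: multi_indices_def\<close>)
qed

text \<open>Centred at \<open>p\<close>, each coordinate of \<open>x - p\<close> is a single
  monomial of degree one. A linear functional is a combination of these plus the constant
  \<open>p \<bullet> v\<close>.\<close>

lemma real_analytic_at_inner_left:
  fixes p v :: "'a::euclidean_space"
  shows "real_analytic_at (\<lambda>x. x \<bullet> v) p"
proof -
  have coord: "real_analytic_at (\<lambda>x. (x - p) \<bullet> b) p" if "b \<in> Basis" for b :: 'a
  proof (rule real_analytic_at_regroup[where I = "{(\<lambda>i. if i = b then 1 else 0)}" and r = 1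
        and k = id and a = "\<lambda>_. 1"])
    have "mpow (y - p) (\<lambda>i. if i = b then 1 else 0) = (y - p) \<bullet> b" for y
      using that by (simp add: mpow_def if_distrib[of "\<lambda>n. _ ^ n"] cong: if_cong)
    then show "((\<lambda>i. mpow (y - p) (id i) * 1) has_sum (y - p) \<bullet> b) {(\<lambda>i. if i = b then 1 else 0)}" for y
      by (intro has_sum_finiteI) auto
  qed (use that in \<open>auto simp: multi_indices_def\<close>)
  have "real_analytic_at (\<lambda>x. (\<Sum>b\<in>Basis. ((x - p) \<bullet> b) * (b \<bullet> v)) + p \<bullet> v) p"
    by (intro real_analytic_at_add real_analytic_at_sum real_analytic_at_mult coord real_analytic_at_const)
  also have "(\<lambda>x. (\<Sum>b\<in>Basis. ((x - p) \<bullet> b) * (b \<bullet> v)) + p \<bullet> v) = (\<lambda>x. x \<bullet> v)"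
  proof
    fix x
    have "(x - p) \<bullet> v = (\<Sum>b\<in>Basis. ((x - p) \<bullet> b) * (b \<bullet> v))"
      using euclidean_inner[of "x - p" v] by (simp add: inner_commute[of _ v])
    then show "(\<Sum>b\<in>Basis. ((x - p) \<bullet> b) * (b \<bullet> v)) + p \<bullet> v = x \<bullet> v"
      by (simp add: inner_diff_left)
  qed
  finally show ?thesis .
qed

text \<open>Expanding the powers of the inner series multiplies out to a series indexed by lists of multi-indices.
  It converges absolutely near \<open>p\<close> because the inner series has no constant term, so shrinking the
  radius by \<open>s\<close> shrinks its absolute sum by \<open>s\<close> as well.\<close>

lemma real_analytic_at_power_series_compose:
  fixes f :: "'a::euclidean_space \<Rightarrow> real"
  assumes f: "real_analytic_at f p" and "\<rho> > 0"
    and h: "\<And>t. \<bar>t\<bar> < \<rho> \<Longrightarrow> (\<lambda>k. h k * t ^ k) sums H (f p + t)"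
  shows "real_analytic_at (\<lambda>x. H (f x)) p"
proof -
  let ?M = "multi_indices TYPE('a)"
  let ?deg = "\<lambda>\<kappa> :: 'a \<Rightarrow> nat. \<Sum>b\<in>Basis. \<kappa> b"
  \<comment> \<open>Subtracting \<open>f p\<close> removes the constant term of the inner
    series.\<close>
  have "real_analytic_at (\<lambda>x. f x + - f p) p"
    by (intro real_analytic_at_add f real_analytic_at_const)
  then obtain r c where "r > 0" and c: "\<And>y. y \<in> ball p r \<Longrightarrow>
      ((\<lambda>\<kappa>. mpow (y - p) \<kappa> * c \<kappa>) has_sum f y - f p) ?M"
    by (rule real_analytic_atE) (rule that, auto simp del: mem_ball)
  have c0: "c (\<lambda>_. 0) = 0"
  proof -
    \<comment> \<open>At \<open>y = p\<close> only the constant monomial survives, so the sum is its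
      coefficient as well as \<open>f p - f p\<close>.\<close>
    have "((\<lambda>\<kappa>. mpow (p - p) \<kappa> * c \<kappa>) has_sum c (\<lambda>_. 0)) ?M"
      by (rule has_sum_finite_neutralI[of "{\<lambda>_. 0}"]) (auto simp: mpow_at_zero, auto simp: multi_indices_def)
    then show ?thesis using has_sum_unique[OF _ c[of p]] \<open>r > 0\<close> by simp
  qed
  define t where "t = r / (2 * (norm (\<Sum>Basis :: 'a) + 1))"
  have "norm (\<Sum>Basis :: 'a) + 1 > 0" by (smt (verit) norm_ge_zero)
  then have t: "t > 0" "norm (t *\<^sub>R (\<Sum>Basis :: 'a)) < r"
    using \<open>r > 0\<close> by (auto simp: t_def field_simps add_pos_nonneg)
  have "p + t *\<^sub>R (\<Sum>Basis) \<in> ball p r"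
    using t by (simp add: dist_norm)
  from has_sum_imp_summable[OF c[OF this]]
  have "(\<lambda>\<kappa>. t ^ ?deg \<kappa> * c \<kappa>) summable_on ?M" by (simp add: mpow_One)
  then have "(\<lambda>\<kappa>. t ^ ?deg \<kappa> * \<bar>c \<kappa>\<bar>) summable_on ?M"
    using \<open>t > 0\<close> by (subst (asm) summable_on_iff_abs_summable_on_real) (simp add: abs_mult)
  then obtain M where M: "((\<lambda>\<kappa>. t ^ ?deg \<kappa> * \<bar>c \<kappa>\<bar>) has_sum M) ?M"
    by (auto simp: summable_on_def)
  have "M \<ge> 0" using \<open>t > 0\<close> by (intro has_sum_nonneg[OF M]) auto
  \<comment> \<open>The bound 1 ensures \<open>s ^ d \<le> s\<close> for degrees
    \<open>d \<ge> 1\<close>; the other bound gives \<open>s * M < \<rho>\<close>, where the added 1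
    keeps the denominator positive if \<open>M = 0\<close>.\<close>
  define s where "s = min 1 (\<rho> / (2 * (M + 1)))"
  have s: "s > 0" "s \<le> 1" using \<open>M \<ge> 0\<close> \<open>\<rho> > 0\<close> by (auto simp: s_def)
  have "s * M \<le> \<rho> / (2 * (M + 1)) * M"
    using \<open>M \<ge> 0\<close> by (intro mult_right_mono) (auto simp: s_def)
  also have "\<dots> < \<rho>" using \<open>M \<ge> 0\<close> \<open>\<rho> > 0\<close> by (simp add: field_simps) (smt (verit) mult_nonneg_nonneg)
  finally have sM: "s * M < \<rho>" .
  show ?thesis
  proof (rule real_analytic_at_regroup[where r = "min r (s * t)" and I = "lists ?M"
        and k = "\<lambda>l b. \<Sum>\<kappa>\<leftarrow>l. \<kappa> b" and a = "\<lambda>l. h (length l) * (\<Prod>\<kappa>\<leftarrow>l. c \<kappa>)"])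
    show "min r (s * t) > 0" using \<open>r > 0\<close> s t by simp
    have "sum_list (map (\<lambda>\<kappa>. \<kappa> b) l) = 0" if "l \<in> lists ?M" "b \<notin> Basis" for l b
      using that by (induction l) (auto simp: multi_indices_def)
    then show "(\<lambda>l b. \<Sum>\<kappa>\<leftarrow>l. \<kappa> b) ` lists ?M \<subseteq> ?M"
      by (auto simp: multi_indices_def)
  next
    fix y assume y: "y \<in> ball p (min r (s * t))"
    define u where "u \<kappa> = mpow (y - p) \<kappa> * c \<kappa>" for \<kappa>
    have u: "(u has_sum f y - f p) ?M" using c[of y] y by (simp add: u_def[abs_def])
    then have "(\<lambda>\<kappa>. \<bar>u \<kappa>\<bar>) summable_on ?M"
      using summable_on_iff_abs_summable_on_real[of u ?M] has_sum_imp_summable by auto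
    then obtain F where F: "((\<lambda>\<kappa>. \<bar>u \<kappa>\<bar>) has_sum F) ?M" by (auto simp: summable_on_def)
    have "F \<ge> 0" by (rule has_sum_nonneg[OF F]) auto
    have "F \<le> s * M"
    proof (rule has_sum_mono[OF F has_sum_cmult_right[OF M]])
      fix \<kappa> assume \<kappa>: "\<kappa> \<in> ?M"
      show "\<bar>u \<kappa>\<bar> \<le> s * (t ^ ?deg \<kappa> * \<bar>c \<kappa>\<bar>)"
      proof (cases "\<kappa> = (\<lambda>_. 0)")
        case False
        have "\<bar>mpow (y - p) \<kappa>\<bar> \<le> (s * t) ^ ?deg \<kappa>"
          using y by (intro abs_mpow_le) (simp add: dist_norm norm_minus_commute)
        also have "\<dots> = s ^ ?deg \<kappa> * t ^ ?deg \<kappa>" by (rule power_mult_distrib)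
        \<comment> \<open>A nonconstant monomial has degree at least one, so it gains at least one
          factor \<open>s\<close>.\<close>
        also have "\<dots> \<le> s ^ 1 * t ^ ?deg \<kappa>"
          using s t multi_index_size_pos[OF \<kappa> False] by (intro mult_right_mono power_decreasing) auto
        finally show ?thesis by (simp add: u_def abs_mult mult_right_mono flip: mult.assoc)
      qed (simp add: u_def c0)
    qed
    then have "F < \<rho>" using sM by simp
    \<comment> \<open>Convergence at the midpoint of \<open>F\<close> and \<open>\<rho>\<close>,
      which lies inside the disc of convergence, gives absolute convergence at the smaller point
      \<open>F\<close>.\<close>
    have "summable (\<lambda>k. norm (h k * F ^ k))"
      by (rule powser_insidea[where x = "(F + \<rho>) / 2"])
        (use \<open>F \<ge> 0\<close> \<open>F < \<rho>\<close> in \<open>auto intro!: sums_summable[OF h]\<close>)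
    then have summ: "summable (\<lambda>k. \<bar>h k\<bar> * F ^ k)" using \<open>F \<ge> 0\<close> by (simp add: abs_mult)
    have "\<bar>f y - f p\<bar> \<le> F" using norm_has_sum_bound[of u ?M F] u F by simp
    then have "(\<lambda>k. h k * (f y - f p) ^ k) sums H (f y)"
      using h[of "f y - f p"] \<open>F < \<rho>\<close> by simp
    from has_sum_lists_power_series[OF u F summ this]
    have "((\<lambda>l. h (length l) * (\<Prod>\<kappa>\<leftarrow>l. u \<kappa>)) has_sum H (f y)) (lists ?M)" .
    moreover have "(\<Prod>\<kappa>\<leftarrow>l. u \<kappa>) = mpow (y - p) (\<lambda>b. \<Sum>\<kappa>\<leftarrow>l. \<kappa> b) * (\<Prod>\<kappa>\<leftarrow>l. c \<kappa>)" for l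
      unfolding mpow_sum_list by (induction l) (auto simp: u_def)
    ultimately show "((\<lambda>l. mpow (y - p) (\<lambda>b. \<Sum>\<kappa>\<leftarrow>l. \<kappa> b) * (h (length l) * (\<Prod>\<kappa>\<leftarrow>l. c \<kappa>)))
        has_sum H (f y)) (lists ?M)"
      by (simp add: mult_ac)
  qed
qed

text \<open>The binomial series of \<open>(f p + t) powr a\<close> in \<open>t\<close> converges for
  \<open>\<bar>t\<bar> < f p\<close>, so \<open>f p\<close> is the radius \<open>\<rho>\<close> of
  the outer series.\<close>

lemma real_analytic_at_powr:
  fixes f :: "'a::euclidean_space \<Rightarrow> real"
  assumes "real_analytic_at f p" "f p > 0"
  shows "real_analytic_at (\<lambda>x. f x powr a) p"
  by (rule real_analytic_at_power_series_compose[OF assms]) (rule gen_binomial_real'')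

lemma real_analytic_at_diff:
  fixes f g :: "'a::euclidean_space \<Rightarrow> real"
  assumes "real_analytic_at f p" "real_analytic_at g p"
  shows "real_analytic_at (\<lambda>x. f x - g x) p"
  using real_analytic_at_add[OF assms(1) real_analytic_at_mult[OF real_analytic_at_const[of "-1"] assms(2)]]
  by simp

text \<open>A real power needs a positive base, while \<open>f p\<close> may be negative; the
  reciprocal is therefore written as \<open>f\<close> times a power of its square. Where
  \<open>f\<close> vanishes, both expressions are 0.\<close>

lemma real_analytic_at_inverse:
  fixes f :: "'a::euclidean_space \<Rightarrow> real"
  assumes "real_analytic_at f p" "f p \<noteq> 0"
  shows "real_analytic_at (\<lambda>x. inverse (f x)) p"
proof -
  have "real_analytic_at (\<lambda>x. f x * (f x * f x) powr - 1) p"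
    using assms by (intro real_analytic_at_mult real_analytic_at_powr) (auto simp flip: power2_eq_square)
  also have "(\<lambda>x. f x * (f x * f x) powr - 1) = (\<lambda>x. inverse (f x))"
    by (auto simp: powr_minus field_simps)
  finally show ?thesis .
qed

lemma real_analytic_at_euclidean:
  fixes f :: "'a::euclidean_space \<Rightarrow> 'b::euclidean_space"
  assumes "\<And>b. b \<in> Basis \<Longrightarrow> real_analytic_at (\<lambda>x. f x \<bullet> b) p"
  shows "real_analytic_at f p"
proof -
  have "real_analytic_at (\<lambda>x. \<Sum>b\<in>Basis. (f x \<bullet> b) *\<^sub>R b) p"
    by (intro real_analytic_at_sum real_analytic_at_scaleR_const assms)
  then show ?thesis by (simp add: euclidean_representation)
qed

lemma real_analytic_at_inner:
  fixes f g :: "'a::euclidean_space \<Rightarrow> 'b::euclidean_space"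
  assumes "\<And>b. b \<in> Basis \<Longrightarrow> real_analytic_at (\<lambda>x. f x \<bullet> b) p"
    and "\<And>b. b \<in> Basis \<Longrightarrow> real_analytic_at (\<lambda>x. g x \<bullet> b) p"
  shows "real_analytic_at (\<lambda>x. f x \<bullet> g x) p"
  unfolding euclidean_inner[of "f _" "g _"]
  by (intro real_analytic_at_sum real_analytic_at_mult assms)

section \<open>Analyticity of the remainder kernel\<close>

text \<open>Each of these functions is the inner product with a vector supported in a single
  slot.\<close>

lemma real_analytic_at_components:
  fixes p :: "'a::euclidean_space \<times> 'a \<times> 'a \<times> 'a \<times> 'a"
  shows "real_analytic_at (\<lambda>z :: 'a \<times> 'a \<times> 'a \<times> 'a \<times> 'a. fst z \<bullet> v) p"
    and "real_analytic_at (\<lambda>z :: 'a \<times> 'a \<times> 'a \<times> 'a \<times> 'a. fst (snd z) \<bullet> v) p"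
    and "real_analytic_at (\<lambda>z :: 'a \<times> 'a \<times> 'a \<times> 'a \<times> 'a. fst (snd (snd z)) \<bullet> v) p"
    and "real_analytic_at (\<lambda>z :: 'a \<times> 'a \<times> 'a \<times> 'a \<times> 'a. fst (snd (snd (snd z))) \<bullet> v) p"
    and "real_analytic_at (\<lambda>z :: 'a \<times> 'a \<times> 'a \<times> 'a \<times> 'a. snd (snd (snd (snd z))) \<bullet> v) p"
  using real_analytic_at_inner_left[of "(v, 0, 0, 0, 0)" p]
    real_analytic_at_inner_left[of "(0, v, 0, 0, 0)" p]
    real_analytic_at_inner_left[of "(0, 0, v, 0, 0)" p]
    real_analytic_at_inner_left[of "(0, 0, 0, v, 0)" p]
    real_analytic_at_inner_left[of "(0, 0, 0, 0, v)" p]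
  by (simp_all add: inner_prod_def)

text \<open>The function \<open>g\<close> of the paper. For \<open>norm a = 1\<close> it takes the junk
  value 0, where the difference quotient of the paper would extend by continuity.\<close>

definition energy_quotient :: "real \<Rightarrow> 'a::real_inner \<Rightarrow> real" where
  "energy_quotient \<alpha> a = ((a \<bullet> a) powr (- (\<alpha> + 2) / 2) - 1) * inverse (2 * (1 - a \<bullet> a))"

definition remainder_kernel :: "real \<Rightarrow> 'a::real_inner \<times> 'a \<times> 'a \<times> 'a \<times> 'a \<Rightarrow> 'a" where
  "remainder_kernel \<alpha> = (\<lambda>(a, b, c, d, e). (energy_quotient \<alpha> a * (c \<bullet> d)) *\<^sub>R Pperp b e)"

text \<open>The kernel involves \<open>a\<close> only through the polynomial
  \<open>a \<bullet> a\<close>. On the domain this is positive, as the real power requires, and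
  different from 1, as the reciprocal requires.\<close>

lemma real_analytic_on_remainder_kernel:
  "real_analytic_on (remainder_kernel \<alpha> :: 'a::euclidean_space \<times> 'a \<times> 'a \<times> 'a \<times> 'a \<Rightarrow> 'a) G_domain"
  unfolding real_analytic_on_iff_at
proof (rule ballI, rule real_analytic_at_euclidean)
  fix p :: "'a \<times> 'a \<times> 'a \<times> 'a \<times> 'a" and v :: 'a
  assume "p \<in> G_domain"
  then have a: "norm (fst p) \<noteq> 0" "norm (fst p) \<noteq> 1" by (simp_all add: G_domain_def case_prod_unfold)
  then have pos: "fst p \<bullet> fst p > 0" by simp
  have "fst p \<bullet> fst p \<noteq> 1"
    using a(2) by (auto simp: norm_eq_sqrt_inner)
  then have ne: "2 * (1 - fst p \<bullet> fst p) \<noteq> 0" by simp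
  note comp = real_analytic_at_components[of _ p]
  note inner = real_analytic_at_inner[OF comp(1) comp(1)] real_analytic_at_inner[OF comp(3) comp(4)]
    real_analytic_at_inner[OF comp(5) comp(2)]
  have "real_analytic_at (\<lambda>z :: 'a \<times> 'a \<times> 'a \<times> 'a \<times> 'a.
      ((fst z \<bullet> fst z) powr (- (\<alpha> + 2) / 2) - 1) * inverse (2 * (1 - fst z \<bullet> fst z)) *
      (fst (snd (snd z)) \<bullet> fst (snd (snd (snd z)))) *
      (snd (snd (snd (snd z))) \<bullet> v -
        (snd (snd (snd (snd z))) \<bullet> fst (snd z)) * (fst (snd z) \<bullet> v))) p"
    using pos ne by (intro real_analytic_at_mult real_analytic_at_diff real_analytic_at_inverse
        real_analytic_at_powr real_analytic_at_const comp inner)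
  also have "(\<lambda>z :: 'a \<times> 'a \<times> 'a \<times> 'a \<times> 'a.
      ((fst z \<bullet> fst z) powr (- (\<alpha> + 2) / 2) - 1) * inverse (2 * (1 - fst z \<bullet> fst z)) *
      (fst (snd (snd z)) \<bullet> fst (snd (snd (snd z)))) *
      (snd (snd (snd (snd z))) \<bullet> v -
        (snd (snd (snd (snd z))) \<bullet> fst (snd z)) * (fst (snd z) \<bullet> v)))
      = (\<lambda>z. remainder_kernel \<alpha> z \<bullet> v)"
    by (simp add: fun_eq_iff remainder_kernel_def energy_quotient_def Pperp_def inner_diff_left)
  finally show "real_analytic_at (\<lambda>z. remainder_kernel \<alpha> z \<bullet> v) p" .
qed

section \<open>Chords and tangents of smooth curves\<close>

lemma smooth_curve_vderiv: "smooth_curve f \<Longrightarrow> smooth_curve (vderiv f)"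
  unfolding smooth_curve_def by (metis comp_apply funpow_Suc_right)

lemma smooth_curve_has_vector_derivative:
  assumes "smooth_curve f"
  shows "(f has_vector_derivative vderiv f x) (at x)"
proof -
  have "((vderiv ^^ 0) f) differentiable (at x)"
    using assms unfolding smooth_curve_def by blast
  then show ?thesis by (simp add: vderiv_def flip: vector_derivative_works)
qed

lemma smooth_curve_continuous_on: "smooth_curve f \<Longrightarrow> continuous_on A f"
  by (meson continuous_at_imp_continuous_on has_vector_derivative_continuous
      smooth_curve_has_vector_derivative)

lemma smooth_curve_has_vector_derivative_affine:
  assumes "smooth_curve f"
  shows "((\<lambda>s. f (y + s * w)) has_vector_derivative w *\<^sub>R vderiv f (y + s * w)) (at s within S)"
proof -
  have "((\<lambda>s. y + s * w) has_vector_derivative w) (at s within S)"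
    by (auto intro!: derivative_eq_intros)
  moreover have "(f has_vector_derivative vderiv f (y + s * w)) (at (y + s * w) within (\<lambda>s. y + s * w) ` S)"
    by (rule has_vector_derivative_at_within[OF smooth_curve_has_vector_derivative[OF assms]])
  ultimately show ?thesis
    using vector_diff_chain_within[of "\<lambda>s. y + s * w" w s S f] by (simp add: o_def)
qed

text \<open>Applied to the curve, this writes the chord as \<open>w\<close> times the mean tangent;
  applied to the tangent, it writes a difference of tangents through the mean second
  derivative.\<close>

lemma smooth_curve_has_integral_segment:
  fixes f :: "real \<Rightarrow> 'a::banach"
  assumes "smooth_curve f"
  shows "((\<lambda>s. w *\<^sub>R vderiv f (y + s * w)) has_integral f (y + w) - f y) {0..1}"
  using fundamental_theorem_of_calculus[OF zero_le_one
      smooth_curve_has_vector_derivative_affine[OF assms]] by simp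

lemma smooth_curve_integrable_segment:
  fixes f :: "real \<Rightarrow> 'a::banach"
  assumes "smooth_curve f"
  shows "(\<lambda>s. f (y + s * w)) integrable_on {0..1}"
  by (intro integrable_continuous_real continuous_on_compose2[OF smooth_curve_continuous_on[OF assms, of UNIV]]
      continuous_intros) auto

text \<open>The function \<open>(1 - t) w f'(x + t w) + f(x + t w)\<close> of \<open>t\<close> is an
  antiderivative of the integrand: the first-order terms of its derivative cancel.\<close>

lemma smooth_curve_taylor:
  fixes f :: "real \<Rightarrow> 'a::banach"
  assumes "smooth_curve f"
  shows "w\<^sup>2 *\<^sub>R integral {0..1} (\<lambda>t. (1 - t) *\<^sub>R vderiv (vderiv f) (x + t * w))
    = f (x + w) - f x - w *\<^sub>R vderiv f x"
proof -
  have "((\<lambda>t. w\<^sup>2 *\<^sub>R ((1 - t) *\<^sub>R vderiv (vderiv f) (x + t * w))) has_integral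
      (((1 - 1) * w) *\<^sub>R vderiv f (x + 1 * w) + f (x + 1 * w)) -
      (((1 - 0) * w) *\<^sub>R vderiv f (x + 0 * w) + f (x + 0 * w))) {0..1}"
  proof (rule fundamental_theorem_of_calculus[OF zero_le_one])
    fix t :: real
    have "((\<lambda>t. (1 - t) * w) has_real_derivative - w) (at t within {0..1})"
      by (auto intro!: derivative_eq_intros)
    from has_vector_derivative_add[OF has_vector_derivative_scaleR[OF this
          smooth_curve_has_vector_derivative_affine[OF smooth_curve_vderiv[OF assms]]]
          smooth_curve_has_vector_derivative_affine[OF assms]]
    show "((\<lambda>t. ((1 - t) * w) *\<^sub>R vderiv f (x + t * w) + f (x + t * w)) has_vector_derivative
        w\<^sup>2 *\<^sub>R ((1 - t) *\<^sub>R vderiv (vderiv f) (x + t * w))) (at t within {0..1})"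
      by (rule has_vector_derivative_eq_rhs) (simp add: power2_eq_square algebra_simps)
  qed
  from integral_unique[OF this, unfolded integral_cmul] show ?thesis
    by (simp add: diff_diff_eq add.commute)
qed

section \<open>Evaluation of the fourfold integral\<close>

text \<open>For unit vectors the squared distance is \<open>2 - 2 * (T r1 \<bullet> T r2)\<close>,
  which is affine in each tangent separately, so each integration replaces one tangent by its mean
  \<open>a\<close>.\<close>

lemma unit_tangent_chord:
  fixes T :: "real \<Rightarrow> 'a::euclidean_space"
  assumes "T integrable_on {0..1}" and unit: "\<And>s. norm (T s) = 1"
  defines "a \<equiv> integral {0..1} T"
  shows "integral {0..1} (\<lambda>r2. integral {0..1} (\<lambda>r1. k * (norm (T r1 - T r2))\<^sup>2)) = k * (2 * (1 - a \<bullet> a))"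
proof -
  have T: "(T has_integral a) {0..1}" using assms by blast
  \<comment> \<open>This is used twice: with \<open>v = T r2\<close> for the integral over
    \<open>r1\<close>, then with \<open>v = a\<close> for the one over \<open>r2\<close>.\<close>
  have lin: "((\<lambda>s. k * (2 - 2 * (T s \<bullet> v))) has_integral k * (2 - 2 * (a \<bullet> v))) {0..1}" for v
    using has_integral_mult_right[OF has_integral_diff[OF has_integral_const_real[of 2 0 1]
          has_integral_mult_right[OF has_integral_linear[OF T bounded_linear_inner_left]]], of k 2 v]
    by (simp add: o_def)
  have "k * (norm (T r1 - T r2))\<^sup>2 = k * (2 - 2 * (T r1 \<bullet> T r2))" for r1 r2
    using unit[of r1] unit[of r2]
    by (simp add: power2_norm_eq_inner norm_eq_1 inner_diff_left inner_diff_right inner_commute)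
  then have "integral {0..1} (\<lambda>r2. integral {0..1} (\<lambda>r1. k * (norm (T r1 - T r2))\<^sup>2))
      = integral {0..1} (\<lambda>r2. k * (2 - 2 * (a \<bullet> T r2)))"
    by (simp only: integral_unique[OF lin])
  also have "\<dots> = integral {0..1} (\<lambda>r2. k * (2 - 2 * (T r2 \<bullet> a)))"
    by (simp only: inner_commute)
  also have "\<dots> = k * (2 - 2 * (a \<bullet> a))"
    using lin by (rule integral_unique)
  finally show ?thesis by simp
qed

text \<open>The integrand is bilinear in the two values of \<open>K\<close>, so integrating over
  each parameter replaces the corresponding value by \<open>C\<close>.\<close>

lemma integral_scaleR_inner_pair:
  fixes K :: "real \<Rightarrow> 'a::euclidean_space" and v :: "'b::banach"
  assumes "(K has_integral C) S"
  shows "integral S (\<lambda>\<psi>2. integral S (\<lambda>\<psi>1. k *\<^sub>R ((m * (K \<psi>1 \<bullet> K \<psi>2)) *\<^sub>R v))) = (k * (m * (C \<bullet> C))) *\<^sub>R v"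
proof -
  have lin: "((\<lambda>s. k *\<^sub>R ((m * (K s \<bullet> u)) *\<^sub>R v)) has_integral k *\<^sub>R ((m * (C \<bullet> u)) *\<^sub>R v)) S" for u
  proof -
    have "bounded_linear (\<lambda>z. k *\<^sub>R ((m * (z \<bullet> u)) *\<^sub>R v))"
      by (intro bounded_linear_const_scaleR bounded_linear_scaleR_const
          bounded_linear_const_mult bounded_linear_inner_left)
    from has_integral_linear[OF assms this] show ?thesis by (simp add: o_def)
  qed
  have "integral S (\<lambda>\<psi>2. integral S (\<lambda>\<psi>1. k *\<^sub>R ((m * (K \<psi>1 \<bullet> K \<psi>2)) *\<^sub>R v)))
      = integral S (\<lambda>\<psi>2. k *\<^sub>R ((m * (C \<bullet> K \<psi>2)) *\<^sub>R v))"
    by (simp only: integral_unique[OF lin])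
  also have "\<dots> = integral S (\<lambda>\<psi>2. k *\<^sub>R ((m * (K \<psi>2 \<bullet> C)) *\<^sub>R v))"
    by (simp only: inner_commute)
  also have "\<dots> = (k * (m * (C \<bullet> C))) *\<^sub>R v"
    by (simp only: integral_unique[OF lin]) simp
  finally show ?thesis .
qed

text \<open>For fixed \<open>r1\<close> and \<open>r2\<close> the inner integrals average the second
  derivative along the segment between the two parameters; together with
  \<open>(r1 - r2)\<^sup>2\<close> this gives the squared tangent difference divided by
  \<open>w\<^sup>2\<close>. The outer integrals then average that square.\<close>

lemma fourfold_integral_remainder_kernel:
  fixes \<gamma> :: "real \<Rightarrow> 'a::euclidean_space" and x w :: real
  assumes \<gamma>: "smooth_curve \<gamma>" and unit: "\<And>x. norm (vderiv \<gamma> x) = 1" and "w \<noteq> 0"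
  defines "a \<equiv> integral {0..1} (\<lambda>s. vderiv \<gamma> (x + s * w))"
  shows "integral {0..1} (\<lambda>r2. integral {0..1} (\<lambda>r1. integral {0..1} (\<lambda>\<psi>2. integral {0..1} (\<lambda>\<psi>1.
      (r1 - r2)\<^sup>2 *\<^sub>R remainder_kernel \<alpha> (a, b,
        vderiv (vderiv \<gamma>) (x + r2 * w + (r1 - r2) * \<psi>1 * w),
        vderiv (vderiv \<gamma>) (x + r2 * w + (r1 - r2) * \<psi>2 * w), e)))))
    = ((2 * (1 - a \<bullet> a) * energy_quotient \<alpha> a) / w\<^sup>2) *\<^sub>R Pperp b e"
proof -
  note d\<gamma> = smooth_curve_vderiv[OF \<gamma>]
  define T where "T s = vderiv \<gamma> (x + s * w)" for s
  have inner: "integral {0..1} (\<lambda>\<psi>2. integral {0..1} (\<lambda>\<psi>1.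
      (r1 - r2)\<^sup>2 *\<^sub>R remainder_kernel \<alpha> (a, b,
        vderiv (vderiv \<gamma>) (x + r2 * w + (r1 - r2) * \<psi>1 * w),
        vderiv (vderiv \<gamma>) (x + r2 * w + (r1 - r2) * \<psi>2 * w), e)))
     = (energy_quotient \<alpha> a / w\<^sup>2 * (norm (T r1 - T r2))\<^sup>2) *\<^sub>R Pperp b e" for r1 r2
  proof -
    define h where "h = (r1 - r2) * w"
    define K where "K = (\<lambda>\<psi>. vderiv (vderiv \<gamma>) (x + r2 * w + \<psi> * h))"
    define C where "C = integral {0..1} K"
    have "K integrable_on {0..1}"
      unfolding K_def by (intro smooth_curve_integrable_segment smooth_curve_vderiv d\<gamma>)
    then have C: "(K has_integral C) {0..1}" by (simp add: C_def has_integral_integral)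
    have "((\<lambda>\<psi>. h *\<^sub>R K \<psi>) has_integral T r1 - T r2) {0..1}"
      using smooth_curve_has_integral_segment[OF d\<gamma>, of h "x + r2 * w"]
      by (simp add: K_def T_def h_def algebra_simps)
    with has_integral_cmul[OF C, of h] have "h *\<^sub>R C = T r1 - T r2"
      by (rule has_integral_unique)
    then have "(norm (T r1 - T r2))\<^sup>2 = (norm (h *\<^sub>R C))\<^sup>2" by simp
    also have "\<dots> = h\<^sup>2 * (C \<bullet> C)"
      by (simp add: power_mult_distrib power2_norm_eq_inner)
    \<comment> \<open>Only \<open>w\<^sup>2\<close> is divided out of \<open>h\<^sup>2\<close>; the
      factor \<open>(r1 - r2)\<^sup>2\<close> stays, so the case \<open>r1 = r2\<close> is
      covered.\<close>
    finally have CC: "(r1 - r2)\<^sup>2 * (C \<bullet> C) = (norm (T r1 - T r2))\<^sup>2 / w\<^sup>2"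
      using \<open>w \<noteq> 0\<close> by (simp add: h_def power_mult_distrib)
    have "(\<lambda>\<psi>. vderiv (vderiv \<gamma>) (x + r2 * w + (r1 - r2) * \<psi> * w)) = K"
      by (simp add: K_def h_def fun_eq_iff mult_ac)
    then have "vderiv (vderiv \<gamma>) (x + r2 * w + (r1 - r2) * \<psi> * w) = K \<psi>" for \<psi>
      by metis
    then have "integral {0..1} (\<lambda>\<psi>2. integral {0..1} (\<lambda>\<psi>1.
      (r1 - r2)\<^sup>2 *\<^sub>R remainder_kernel \<alpha> (a, b,
        vderiv (vderiv \<gamma>) (x + r2 * w + (r1 - r2) * \<psi>1 * w),
        vderiv (vderiv \<gamma>) (x + r2 * w + (r1 - r2) * \<psi>2 * w), e)))
       = ((r1 - r2)\<^sup>2 * (energy_quotient \<alpha> a * (C \<bullet> C))) *\<^sub>R Pperp b e"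
      by (simp only: remainder_kernel_def prod.case integral_scaleR_inner_pair[OF C])
    also have "(r1 - r2)\<^sup>2 * (energy_quotient \<alpha> a * (C \<bullet> C)) = energy_quotient \<alpha> a * ((r1 - r2)\<^sup>2 * (C \<bullet> C))"
      by (simp add: mult_ac)
    also have "\<dots> = energy_quotient \<alpha> a / w\<^sup>2 * (norm (T r1 - T r2))\<^sup>2"
      by (simp add: CC)
    finally show ?thesis .
  qed
  have Tint: "T integrable_on {0..1}"
    unfolding T_def by (intro smooth_curve_integrable_segment d\<gamma>)
  have pull: "integral {0..1} (\<lambda>s. F s *\<^sub>R v) = integral {0..1} F *\<^sub>R v"
    if "continuous_on {0..1} F" for F :: "real \<Rightarrow> real" and v :: 'a
    using integral_linear[OF integrable_continuous_real[OF that] bounded_linear_scaleR_left, of v]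
    by (simp add: o_def)
  have Tc: "continuous_on A T" for A
    unfolding T_def by (intro continuous_on_compose2[OF smooth_curve_continuous_on[OF d\<gamma>, of UNIV]] continuous_intros) auto
  define k where "k = energy_quotient \<alpha> a / w\<^sup>2"
  have "integral {0..1} (\<lambda>r2. integral {0..1} (\<lambda>r1. (k * (norm (T r1 - T r2))\<^sup>2) *\<^sub>R Pperp b e))
      = integral {0..1} (\<lambda>r2. integral {0..1} (\<lambda>r1. k * (norm (T r1 - T r2))\<^sup>2) *\<^sub>R Pperp b e)"
    by (intro integral_cong pull continuous_intros Tc)
  also have "\<dots> = integral {0..1} (\<lambda>r2. integral {0..1} (\<lambda>r1. k * (norm (T r1 - T r2))\<^sup>2)) *\<^sub>R Pperp b e"
  proof (rule pull)
    \<comment> \<open>The inner integral depends continuously on \<open>r2\<close> because its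
      integrand is jointly continuous on a compact square.\<close>
    have "continuous_on {0..1} (\<lambda>r2. integral (cbox 0 1) (\<lambda>r1. k * (norm (T r1 - T r2))\<^sup>2))"
      by (intro integral_continuous_on_param[where U = "{0..1}"])
        (auto simp: case_prod_unfold intro!: continuous_intros continuous_on_compose2[OF Tc[of UNIV]])
    then show "continuous_on {0..1} (\<lambda>r2. integral {0..1} (\<lambda>r1. k * (norm (T r1 - T r2))\<^sup>2))"
      by simp
  qed
  also have "integral {0..1} (\<lambda>r2. integral {0..1} (\<lambda>r1. k * (norm (T r1 - T r2))\<^sup>2)) = k * (2 * (1 - a \<bullet> a))"
    unfolding a_def T_def[symmetric] by (intro unit_tangent_chord Tint) (simp add: T_def unit)
  also have "k * (2 * (1 - a \<bullet> a)) = (2 * (1 - a \<bullet> a) * energy_quotient \<alpha> a) / w\<^sup>2"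
    by (simp add: k_def)
  finally show ?thesis
    by (simp only: inner k_def)
qed

section \<open>Projection, integrability and the powers of \<open>w\<close> in the integrand\<close>

lemma bounded_linear_Pperp: "bounded_linear (Pperp t)"
  unfolding Pperp_def
  by (intro bounded_linear_sub bounded_linear_ident bounded_linear_scaleR_const bounded_linear_inner_left)

lemma integrable_on_Rdom:
  fixes f :: "real \<Rightarrow> 'a::euclidean_space"
  assumes "continuous_on (Rdom \<epsilon>) f" "\<epsilon> > 0"
  shows "f integrable_on Rdom \<epsilon>"
proof -
  have eq: "Rdom \<epsilon> = {-1/2..-\<epsilon>} \<union> {\<epsilon>..1/2}"
    using \<open>\<epsilon> > 0\<close> by (auto simp: Rdom_def abs_le_iff abs_if split: if_splits)
  have "{-1/2..-\<epsilon>} \<inter> {\<epsilon>..1/2} = {}" using \<open>\<epsilon> > 0\<close> by auto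
  then show ?thesis
    using assms(1) unfolding eq
    by (intro integrable_Un integrable_continuous_real) (auto elim: continuous_on_subset)
qed

text \<open>Multiplying by \<open>1 - a \<bullet> a\<close> cancels the denominator. For
  \<open>norm a = 1\<close> both sides are 0 whatever value the quotient takes there, so the
  identity extends beyond the domain of analyticity.\<close>

lemma energy_quotient_mult:
  assumes "a \<noteq> 0"
  shows "2 * (1 - a \<bullet> a) * energy_quotient \<alpha> a = 1 / norm a powr (\<alpha> + 2) - 1"
proof -
  have "(a \<bullet> a) powr (- (\<alpha> + 2) / 2) = ((norm a)\<^sup>2) powr (- (\<alpha> + 2) / 2)"
    by (simp add: power2_norm_eq_inner)
  also have "(norm a)\<^sup>2 = norm a powr 2"
    using assms by (simp add: powr_numeral)
  also have "(norm a powr 2) powr (- (\<alpha> + 2) / 2) = norm a powr (- (\<alpha> + 2))"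
    unfolding powr_powr by (rule arg_cong[where f = "(powr) _"]) simp
  also have "\<dots> = 1 / norm a powr (\<alpha> + 2)"
    unfolding powr_minus by (simp add: divide_inverse)
  finally have *: "(a \<bullet> a) powr (- (\<alpha> + 2) / 2) = 1 / norm a powr (\<alpha> + 2)" .
  show ?thesis
  proof (cases "a \<bullet> a = 1")
    case True
    then have "norm a = 1" by (simp add: norm_eq_1)
    then show ?thesis using True by simp
  next
    case False
    then have "2 * (1 - a \<bullet> a) * (z * inverse (2 * (1 - a \<bullet> a))) = z" for z
      by (simp add: field_simps)
    then show ?thesis unfolding energy_quotient_def * .
  qed
qed

text \<open>The bookkeeping rests on \<open>\<bar>w\<bar> powr (\<alpha> + 2) = \<bar>w\<bar> powr
  (\<alpha> - 2) * w ^ 4\<close>: two of the four powers cancel the \<open>w\<^sup>2\<close> of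
  Taylor's formula, and the other two are the division by \<open>w\<^sup>2\<close> in the fourfold
  integral.\<close>

lemma R1_integrand_eq:
  fixes a :: "'a::real_inner"
  assumes "a \<noteq> 0" "w \<noteq> 0"
  shows "(1 / \<bar>w\<bar> powr (\<alpha> - 2)) * ((2 * (1 - a \<bullet> a) * energy_quotient \<alpha> a) / w\<^sup>2)
    = (1 / norm (w *\<^sub>R a) powr (\<alpha> + 2) - 1 / \<bar>w\<bar> powr (\<alpha> + 2)) * w\<^sup>2"
proof -
  have "\<bar>w\<bar> powr (\<alpha> + 2) = \<bar>w\<bar> powr ((\<alpha> - 2) + 4)" by (simp add: add.commute)
  also have "\<dots> = \<bar>w\<bar> powr (\<alpha> - 2) * \<bar>w\<bar> ^ 4"
    using assms(2) by (subst powr_add) (simp add: powr_numeral)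
  finally have w: "\<bar>w\<bar> powr (\<alpha> + 2) = \<bar>w\<bar> powr (\<alpha> - 2) * (w\<^sup>2 * w\<^sup>2)"
    by (simp add: power_even_abs flip: power_add)
  show ?thesis
    unfolding energy_quotient_mult[OF assms(1)]
    using assms by (simp add: powr_mult w field_simps)
qed

section \<open>The integral representation of the projected remainder\<close>

theorem theorem6p2:
  fixes \<alpha> :: real
  assumes "2 < \<alpha>" and "\<alpha> < 3"
  shows "\<exists>G :: (real^'n) \<times> (real^'n) \<times> (real^'n) \<times> (real^'n) \<times> (real^'n) \<Rightarrow> real^'n.
    real_analytic_on G G_domain \<and>
    (\<forall>(\<epsilon>::real) (\<gamma> :: real \<Rightarrow> real^'n).
       0 < \<epsilon> \<and> \<epsilon> \<le> 1/2 \<and> smooth_curve \<gamma> \<and> (\<forall>x. \<gamma> (x + 1) = \<gamma> x) \<and>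
       (\<forall>x y. \<gamma> x = \<gamma> y \<longrightarrow> x - y \<in> \<int>) \<and> (\<forall>x. norm (vderiv \<gamma> x) = 1)
       \<longrightarrow> (\<forall>x. Pperp (vderiv \<gamma> x) (R1 \<alpha> \<epsilon> \<gamma> x) =
             integral (Rdom \<epsilon>) (\<lambda>w. (1 / \<bar>w\<bar> powr (\<alpha> - 2)) *\<^sub>R
               integral {0..1} (\<lambda>r2. integral {0..1} (\<lambda>r1.
                 integral {0..1} (\<lambda>\<psi>2. integral {0..1} (\<lambda>\<psi>1.
                   (r1 - r2)\<^sup>2 *\<^sub>R
                   G (integral {0..1} (\<lambda>s. vderiv \<gamma> (x + s * w)),
                      vderiv \<gamma> x,
                      vderiv (vderiv \<gamma>) (x + r2 * w + (r1 - r2) * \<psi>1 * w),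
                      vderiv (vderiv \<gamma>) (x + r2 * w + (r1 - r2) * \<psi>2 * w),
                      integral {0..1} (\<lambda>t. (1 - t) *\<^sub>R vderiv (vderiv \<gamma>) (x + t * w))))))))))"
proof (intro exI conjI allI impI; (elim conjE)?)
  show "real_analytic_on (remainder_kernel \<alpha>) G_domain"
    by (rule real_analytic_on_remainder_kernel)
next
  fix \<epsilon> x :: real and \<gamma> :: "real \<Rightarrow> real^'n"
  assume \<epsilon>: "0 < \<epsilon>" "\<epsilon> \<le> 1/2" and \<gamma>: "smooth_curve \<gamma>"
    and simple: "\<forall>x y. \<gamma> x = \<gamma> y \<longrightarrow> x - y \<in> \<int>" and unit: "\<forall>x. norm (vderiv \<gamma> x) = 1"
  define I where "I w = (1 / norm (\<gamma> (x + w) - \<gamma> x) powr (\<alpha> + 2) - 1 / \<bar>w\<bar> powr (\<alpha> + 2)) *\<^sub>R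
     (\<gamma> (x + w) - \<gamma> x - w *\<^sub>R vderiv \<gamma> x)" for w
  \<comment> \<open>Here \<open>0 < \<bar>w\<bar> < 1\<close>, so \<open>w\<close> is not an integer
    and simplicity of the curve keeps the chord nonzero. This yields continuity of \<open>I\<close>
    and later \<open>a \<noteq> 0\<close>.\<close>
  have chord: "\<gamma> (x + w) \<noteq> \<gamma> x" and w0: "w \<noteq> 0" if "w \<in> Rdom \<epsilon>" for w
  proof -
    have w: "0 < \<bar>w\<bar>" "\<bar>w\<bar> < 1" using that \<epsilon> by (auto simp: Rdom_def)
    then show "w \<noteq> 0" by simp
    have "w \<notin> \<int>"
      using w by (auto elim!: Ints_cases)
    then show "\<gamma> (x + w) \<noteq> \<gamma> x"
      using simple by (metis add_diff_cancel_left')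
  qed
  have "continuous_on (Rdom \<epsilon>) I"
    unfolding I_def
    using chord w0
    by (intro continuous_intros continuous_on_compose2[OF smooth_curve_continuous_on[OF \<gamma>, of UNIV]]) auto
  moreover have "R1 \<alpha> \<epsilon> \<gamma> x = integral (Rdom \<epsilon>) I"
    by (simp add: R1_def I_def[abs_def])
  \<comment> \<open>Continuity makes \<open>I\<close> integrable, so the projection, being bounded
    linear with \<open>x\<close> fixed, passes under the integral.\<close>
  ultimately have "Pperp (vderiv \<gamma> x) (R1 \<alpha> \<epsilon> \<gamma> x) = integral (Rdom \<epsilon>) (\<lambda>w. Pperp (vderiv \<gamma> x) (I w))"
    using integral_linear[OF integrable_on_Rdom[OF _ \<epsilon>(1)] bounded_linear_Pperp, of I]
    by (simp add: o_def)
  also have "\<dots> = integral (Rdom \<epsilon>) (\<lambda>w. (1 / \<bar>w\<bar> powr (\<alpha> - 2)) *\<^sub>R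
               integral {0..1} (\<lambda>r2. integral {0..1} (\<lambda>r1.
                 integral {0..1} (\<lambda>\<psi>2. integral {0..1} (\<lambda>\<psi>1.
                   (r1 - r2)\<^sup>2 *\<^sub>R
                   remainder_kernel \<alpha> (integral {0..1} (\<lambda>s. vderiv \<gamma> (x + s * w)),
                      vderiv \<gamma> x,
                      vderiv (vderiv \<gamma>) (x + r2 * w + (r1 - r2) * \<psi>1 * w),
                      vderiv (vderiv \<gamma>) (x + r2 * w + (r1 - r2) * \<psi>2 * w),
                      integral {0..1} (\<lambda>t. (1 - t) *\<^sub>R vderiv (vderiv \<gamma>) (x + t * w))))))))"
  proof (rule integral_cong)
    fix w assume w: "w \<in> Rdom \<epsilon>"
    define a where "a = integral {0..1} (\<lambda>s. vderiv \<gamma> (x + s * w))"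
    define e where "e = integral {0..1} (\<lambda>t. (1 - t) *\<^sub>R vderiv (vderiv \<gamma>) (x + t * w))"
    have wa: "w *\<^sub>R a = \<gamma> (x + w) - \<gamma> x"
      using integral_unique[OF smooth_curve_has_integral_segment[OF \<gamma>, of w x]] by (simp add: a_def)
    then have "a \<noteq> 0" using chord[OF w] by auto
    \<comment> \<open>The chord is \<open>w *\<^sub>R a\<close>, and by Taylor's formula the vector
      factor is \<open>w\<^sup>2 *\<^sub>R e\<close>.\<close>
    have "I w = ((1 / norm (w *\<^sub>R a) powr (\<alpha> + 2) - 1 / \<bar>w\<bar> powr (\<alpha> + 2)) * w\<^sup>2) *\<^sub>R e"
      using smooth_curve_taylor[OF \<gamma>, of w x] by (simp add: I_def wa e_def flip: scaleR_scaleR)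
    also have "\<dots> = ((1 / \<bar>w\<bar> powr (\<alpha> - 2)) * ((2 * (1 - a \<bullet> a) * energy_quotient \<alpha> a) / w\<^sup>2)) *\<^sub>R e"
      by (simp only: R1_integrand_eq[OF \<open>a \<noteq> 0\<close> w0[OF w]])
    finally have "Pperp (vderiv \<gamma> x) (I w) = (1 / \<bar>w\<bar> powr (\<alpha> - 2)) *\<^sub>R
        ((2 * (1 - a \<bullet> a) * energy_quotient \<alpha> a) / w\<^sup>2) *\<^sub>R Pperp (vderiv \<gamma> x) e"
      by (simp only: linear_cmul[OF bounded_linear.linear[OF bounded_linear_Pperp]] scaleR_scaleR)
    also have "((2 * (1 - a \<bullet> a) * energy_quotient \<alpha> a) / w\<^sup>2) *\<^sub>R Pperp (vderiv \<gamma> x) e =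
       integral {0..1} (\<lambda>r2. integral {0..1} (\<lambda>r1.
                 integral {0..1} (\<lambda>\<psi>2. integral {0..1} (\<lambda>\<psi>1.
                   (r1 - r2)\<^sup>2 *\<^sub>R
                   remainder_kernel \<alpha> (a, vderiv \<gamma> x,
                      vderiv (vderiv \<gamma>) (x + r2 * w + (r1 - r2) * \<psi>1 * w),
                      vderiv (vderiv \<gamma>) (x + r2 * w + (r1 - r2) * \<psi>2 * w), e)))))"
      unfolding a_def using unit by (intro fourfold_integral_remainder_kernel[OF \<gamma> _ w0[OF w], symmetric]) auto
    finally show "Pperp (vderiv \<gamma> x) (I w) = (1 / \<bar>w\<bar> powr (\<alpha> - 2)) *\<^sub>R
               integral {0..1} (\<lambda>r2. integral {0..1} (\<lambda>r1.
                 integral {0..1} (\<lambda>\<psi>2. integral {0..1} (\<lambda>\<psi>1.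
                   (r1 - r2)\<^sup>2 *\<^sub>R
                   remainder_kernel \<alpha> (integral {0..1} (\<lambda>s. vderiv \<gamma> (x + s * w)),
                      vderiv \<gamma> x,
                      vderiv (vderiv \<gamma>) (x + r2 * w + (r1 - r2) * \<psi>1 * w),
                      vderiv (vderiv \<gamma>) (x + r2 * w + (r1 - r2) * \<psi>2 * w),
                      integral {0..1} (\<lambda>t. (1 - t) *\<^sub>R vderiv (vderiv \<gamma>) (x + t * w)))))))"
      by (simp only: a_def e_def)
  qed
  finally show "Pperp (vderiv \<gamma> x) (R1 \<alpha> \<epsilon> \<gamma> x) =
             integral (Rdom \<epsilon>) (\<lambda>w. (1 / \<bar>w\<bar> powr (\<alpha> - 2)) *\<^sub>R
               integral {0..1} (\<lambda>r2. integral {0..1} (\<lambda>r1.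
                 integral {0..1} (\<lambda>\<psi>2. integral {0..1} (\<lambda>\<psi>1.
                   (r1 - r2)\<^sup>2 *\<^sub>R
                   remainder_kernel \<alpha> (integral {0..1} (\<lambda>s. vderiv \<gamma> (x + s * w)),
                      vderiv \<gamma> x,
                      vderiv (vderiv \<gamma>) (x + r2 * w + (r1 - r2) * \<psi>1 * w),
                      vderiv (vderiv \<gamma>) (x + r2 * w + (r1 - r2) * \<psi>2 * w),
                      integral {0..1} (\<lambda>t. (1 - t) *\<^sub>R vderiv (vderiv \<gamma>) (x + t * w))))))))" .
qed

end
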